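(* Let $\epsilon>0$, let $c_{\mathcal{X}}:\mathcal{X}\times\mathcal{X}\to[0,\infty)$ be a cost function on $\mathcal{X}$, and define $$\tilde{c}_{\mathcal{X}}(x,x')=\begin{cases} c_{\mathcal{X}}(x,x') & \text{if } c_{\mathcal{X}}(x,x')\le\epsilon,\\ \infty & \text{otherwise,}\end{cases}\qquad B_{\epsilon}(x)=\{x'\in\mathcal{X}: c_{\mathcal{X}}(x,x')\le\epsilon\}.$$ Let $\mathbb{P}$ be a probability distribution of pairs $(x,y)\in\mathcal{X}\times\mathcal{Y}$ and let $(g_\theta)_{\theta\in\Theta}$ be a family of risk functions $g_\theta:\mathcal{X}\times\mathcal{X}\times\mathcal{Y}\to\mathbb{R}$. Then the optimization problem $$\inf_{\theta\in\Theta,\ \lambda\ge 0}\left(\lambda\epsilon+\mathbb{E}_{(x,y)\sim\mathbb{P}}\left[\sup_{x'\in\mathcal{X}}\left\{g_\theta(x',x,y)-\lambda\,\tilde{c}_{\mathcal{X}}(x',x)\right\}\right]\right)$$ is equivalent to the optimization problem $$\inf_{\theta\in\Theta}\ \mathbb{E}_{(x,y)\sim\mathbb{P}}\left[\sup_{x'\in B_\epsilon(x)} g_\theta(x',x,y)\right],$$ in the sense that for every $\theta\in\Theta$, $$\inf_{\lambda\ge 0}\left(\lambda\epsilon+\mathbb{E}_{\mathbb{P}}\left[\sup_{x'\in\mathcal{X}}\left\{g_\theta(x',x,y)-\lambda\,\tilde{c}_{\mathcal{X}}(x',x)\right\}\right]\right)=\mathbb{E}_{\mathbb{P}}\left[\sup_{x'\in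 B_\epsilon(x)} g_\theta(x',x,y)\right].$$
   Context: $\mathcal{X}$ (data space) and $\mathcal{Y}$ (label space) are Polish spaces and $\Theta$ is an arbitrary nonempty set of model parameters. The cost $c_{\mathcal{X}}$ (for example, the $L_1$, $L_2$ or $L_\infty$ distance) is symmetric, nonnegative, lower semi-continuous, and satisfies $c_{\mathcal{X}}(x,x')=0$ iff $x=x'$. Each $g_\theta$ is upper semi-continuous, and $(x,y)\mapsto g_\theta(x,x,y)$ is in $L^1(\mathbb{P})$; hence the expectations in the claim are well defined with values in $(-\infty,\infty]$ (suprema are measurable with respect to the $\mathbb{P}$-completion). Conventions: $\lambda\cdot\infty=\infty$ for $\lambda>0$, and $0\cdot\infty=0$ (so for $\lambda=0$ the inner supremum is $\sup_{x'\in\mathcal{X}}g_\theta(x',x,y)$). The risk functions considered are built from a classifier $h_\theta$ mapping $x$ to a vector of class probabilities $([h_\theta(x)]_k)_k$, with a trade-off parameter $\beta>0$. With $CE(h_\theta(x),y)=-\log[h_\theta(x)]_y$, $D_{KL}$ the Kullback–Leibler divergence, and $BCE(h_\theta(x),y)=-\log([h_\theta(x)]_y)-\log(1-\max_{k\ne y}[h_\theta(x)]_k)$, they include: - $g_\theta(x',x,y)=CE(h_\theta(x),y)+\beta\,CE(h_\theta(x'),y)$, - $g_\theta(x',x,y)=CE(h_\theta(x),y)+\beta\,D_{KL}(h_\theta(x'),h_\theta(x))$, - $g_\theta(x',x,y)=BCE(h_\theta(x),y)+\beta(1-[h_\theta(x)]_y)\,D_{KL}(h_\theta(x'),h_\theta(x))$.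 *)

theory Defs
  imports "HOL-Probability.Probability"
begin

definition lower_semicont :: "('a::topological_space \<Rightarrow> real) \<Rightarrow> bool" where
  "lower_semicont f \<longleftrightarrow> (\<forall>a. open {x. a < f x})"

definition upper_semicont :: "('a::topological_space \<Rightarrow> real) \<Rightarrow> bool" where
  "upper_semicont f \<longleftrightarrow> (\<forall>a. open {x. f x < a})"

definition cost_function :: "('x::topological_space \<Rightarrow> 'x \<Rightarrow> real) \<Rightarrow> bool" where
  "cost_function c \<longleftrightarrow>
     (\<forall>x x'. c x x' = c x' x) \<and>
     (\<forall>x x'. 0 \<le> c x x') \<and>
     (\<forall>x x'. c x x' = 0 \<longleftrightarrow> x = x') \<and>
     lower_semicont (\<lambda>(x, x'). c x x')"

definition truncated_cost :: "real \<Rightarrow> ('x \<Rightarrow> 'x \<Rightarrow> real) \<Rightarrow> 'x \<Rightarrow> 'x \<Rightarrow> ereal" where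
  "truncated_cost \<epsilon> c x x' = (if c x x' \<le> \<epsilon> then ereal (c x x') else \<infinity>)"

definition cost_ball :: "real \<Rightarrow> ('x \<Rightarrow> 'x \<Rightarrow> real) \<Rightarrow> 'x \<Rightarrow> 'x set" where
  "cost_ball \<epsilon> c x = {x'. c x x' \<le> \<epsilon>}"

text \<open>
  Expectation of an extended-real random variable with respect to the completion of \<open>P\<close>:
  integral of the positive part minus integral of the negative part
  (\<^const>\<open>e2ennreal\<close> maps negative arguments to 0).
  It is meant for functions measurable with respect to the completion whose positive or
  negative part has finite integral.
\<close>

definition ereal_expectation :: "'a measure \<Rightarrow> ('a \<Rightarrow> ereal) \<Rightarrow> ereal" where
  "ereal_expectation P f =
     enn2ereal (\<integral>\<^sup>+ z. e2ennreal (f z) \<partial>completion P)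
     - enn2ereal (\<integral>\<^sup>+ z. e2ennreal (- f z) \<partial>completion P)"

text \<open>
  In \<^typ>\<open>ereal\<close>, \<open>0 * \<infinity> = 0\<close> and \<open>lam * \<infinity> = \<infinity>\<close> for \<open>lam > 0\<close>. Hence points outside the ball
  contribute \<open>-\<infinity>\<close> to the supremum below when \<open>lam > 0\<close> and are unpenalised when \<open>lam = 0\<close>.
\<close>

definition penalized_objective ::
  "real \<Rightarrow> ('x \<Rightarrow> 'x \<Rightarrow> real) \<Rightarrow> ('x \<times> 'y) measure \<Rightarrow> ('x \<Rightarrow> 'x \<Rightarrow> 'y \<Rightarrow> real) \<Rightarrow> real \<Rightarrow> ereal" where
  "penalized_objective \<epsilon> c P g lam =
     ereal (lam * \<epsilon>) +
     ereal_expectation P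
       (\<lambda>(x, y). SUP x'. ereal (g x' x y) - ereal lam * truncated_cost \<epsilon> c x' x)"

definition robust_objective ::
  "real \<Rightarrow> ('x \<Rightarrow> 'x \<Rightarrow> real) \<Rightarrow> ('x \<times> 'y) measure \<Rightarrow> ('x \<Rightarrow> 'x \<Rightarrow> 'y \<Rightarrow> real) \<Rightarrow> ereal" where
  "robust_objective \<epsilon> c P g =
     ereal_expectation P (\<lambda>(x, y). SUP x'\<in>cost_ball \<epsilon> c x. ereal (g x' x y))"

end

theory Submission
  imports Defs
begin

text \<open>
  Fix \<open>\<theta>\<close>, let \<open>F\<close> be the supremum of \<open>g\<close> over the \<open>\<epsilon>\<close>-ball and \<open>J\<^sub>\<lambda>\<close> the penalised supremum.
  For \<open>\<lambda> > 0\<close> the truncation excludes every point outside the ball, so \<open>F - \<lambda>\<epsilon> \<le> J\<^sub>\<lambda> \<le> F\<close>, while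
  \<open>J\<^sub>0 \<ge> F\<close>. Hence \<open>\<lambda>\<epsilon> + E J\<^sub>\<lambda> \<ge> E F\<close> for all \<open>\<lambda>\<close>, and \<open>\<lambda> \<rightarrow> 0\<close> gives the converse.

  The measurable projection theorem, which would make \<open>F\<close> measurable for the completion, is avoided:
  the integral of an arbitrary nonnegative function is its lower integral, and the only property
  needed beyond monotonicity, \<open>E F \<le> a + E (F - a)\<close> for \<open>a \<ge> 0\<close>, holds for lower integrals of
  arbitrary functions (the reverse inequality does not).
\<close>

text \<open>Since \<open>a\<close> is nonnegative, the positive part of \<open>F - a\<close> is the
  positive part of \<open>F\<close> lowered by \<open>a\<close> and cut off at 0. Later
  \<open>u\<close> is the value of a simple function.\<close>

lemma e2ennreal_minus_ennreal_mono:
  fixes F :: ereal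
  assumes "0 \<le> a" "u \<le> e2ennreal F"
  shows "u - ennreal a \<le> e2ennreal (F - ereal a)"
proof (cases F)
  case (real r)
  then have "u - ennreal a \<le> ennreal r - ennreal a"
    using assms by (auto intro: ennreal_minus_mono)
  also have "\<dots> = ennreal (r - a)"
    using assms(1) by (simp add: ennreal_minus)
  finally show ?thesis using real by simp
next
  case PInf
  then show ?thesis by simp
next
  case MInf
  then show ?thesis using assms by (simp add: e2ennreal_neg)
qed

text \<open>If \<open>u\<close> exceeds \<open>a\<close> then \<open>F > a\<close>, so
  \<open>v = 0\<close>; if \<open>v\<close> exceeds \<open>a\<close> then \<open>F < 0\<close>, so
  \<open>u = 0\<close>; otherwise \<open>u + v\<close> is at most \<open>a\<close>. The bound
  mentions only \<open>u\<close> and \<open>v\<close>, so it stays measurable for simple functions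
  even where \<open>F\<close> is not.\<close>

lemma add_le_truncated_parts:
  fixes F :: ereal
  assumes a: "0 \<le> a" and u: "u \<le> e2ennreal F" and v: "v \<le> e2ennreal (ereal a - F)"
  shows "u + v \<le> ennreal a + (u - ennreal a) + (v - ennreal a)"
proof -
  have *: "w \<le> ennreal a + (w - ennreal a)" for w
    using ennreal_minus_le_iff[of w "ennreal a" "w - ennreal a"] by simp
  show ?thesis
  proof (cases F)
    case (real r)
    have "u \<le> ennreal r" "v \<le> ennreal (a - r)"
      using u v real by auto
    then obtain p q where p: "u = ennreal p" "0 \<le> p" and q: "v = ennreal q" "0 \<le> q"
      by (metis ennreal_cases ennreal_neq_top neq_top_trans)
    have "p \<le> max 0 r" "q \<le> max 0 (a - r)"
      using \<open>u \<le> ennreal r\<close> \<open>v \<le> ennreal (a - r)\<close> p q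
      by (auto simp: max_def ennreal_le_iff2)
    then have "p + q \<le> a + max 0 (p - a) + max 0 (q - a)"
      using a p q by (auto simp: max_def split: if_splits)
    then have "ennreal (p + q) \<le> ennreal (a + max 0 (p - a) + max 0 (q - a))"
      by (rule ennreal_leI)
    then show ?thesis
      using a p q by (simp add: ennreal_minus)
  next
    case PInf
    then show ?thesis using v * by (simp add: e2ennreal_neg)
  next
    case MInf
    then show ?thesis using u * by (simp add: e2ennreal_neg)
  qed
qed

text \<open>This is \<open>E F \<le> a + E (F - a)\<close> with the negative parts moved across, so
  that nothing is subtracted. Both integrals on the left are suprema over simple minorants
  \<open>u\<close>, \<open>v\<close>, so bounding those suffices; the right side enters only through
  monotonicity.\<close>

lemma nn_integral_shift_le:
  fixes F :: "'a \<Rightarrow> ereal"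
  assumes a: "0 \<le> a" and M: "emeasure M (space M) = 1"
  shows "(\<integral>\<^sup>+ z. e2ennreal (F z) \<partial>M) + (\<integral>\<^sup>+ z. e2ennreal (ereal a - F z) \<partial>M)
    \<le> ennreal a + (\<integral>\<^sup>+ z. e2ennreal (F z - ereal a) \<partial>M) + (\<integral>\<^sup>+ z. e2ennreal (- F z) \<partial>M)"
    (is "?A + ?B \<le> ?R")
proof -
  have simple: "integral\<^sup>S M u + integral\<^sup>S M v \<le> ?R"
    if u: "simple_function M u" "u \<le> (\<lambda>z. e2ennreal (F z))"
      and v: "simple_function M v" "v \<le> (\<lambda>z. e2ennreal (ereal a - F z))" for u v
  proof -
    have [measurable]: "u \<in> borel_measurable M" "v \<in> borel_measurable M"
      using u v by (auto intro: borel_measurable_simple_function)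
    have "integral\<^sup>S M u + integral\<^sup>S M v = (\<integral>\<^sup>+ z. u z + v z \<partial>M)"
      using u v by (simp add: nn_integral_add nn_integral_eq_simple_integral)
    also have "\<dots> \<le> (\<integral>\<^sup>+ z. ennreal a + (u z - ennreal a) + (v z - ennreal a) \<partial>M)"
      using u v by (intro nn_integral_mono add_le_truncated_parts[OF a]) (auto simp: le_fun_def)
    \<comment> \<open>Additivity is legitimate here because all three summands are measurable; the
      constant integrates to \<open>a\<close> as the total mass is 1.\<close>
    also have "\<dots> = ennreal a + (\<integral>\<^sup>+ z. u z - ennreal a \<partial>M) + (\<integral>\<^sup>+ z. v z - ennreal a \<partial>M)"
      by (simp add: nn_integral_add M)
    also have "\<dots> \<le> ?R"
    proof (intro add_mono order_refl nn_integral_mono)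
      show "u z - ennreal a \<le> e2ennreal (F z - ereal a)" for z
        using u by (intro e2ennreal_minus_ennreal_mono[OF a]) (auto simp: le_fun_def)
      have "ereal a - F z - ereal a = - F z" for z
        by (cases "F z") auto
      then show "v z - ennreal a \<le> e2ennreal (- F z)" for z
        using v e2ennreal_minus_ennreal_mono[OF a, of "v z" "ereal a - F z"]
        by (auto simp: le_fun_def)
    qed
    finally show ?thesis .
  qed
  \<comment> \<open>The zero minorant makes the index sets of both suprema nonempty, as needed to
    move an added constant inside.\<close>
  have zero: "simple_function M (\<lambda>_. 0 :: ennreal)" by simp
  have "?A + integral\<^sup>S M v \<le> ?R"
    if v: "simple_function M v" "v \<le> (\<lambda>z. e2ennreal (ereal a - F z))" for v
    unfolding nn_integral_def[of M "\<lambda>z. e2ennreal (F z)"]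
    by (subst ennreal_SUP_add_left[symmetric])
      (use simple v zero in \<open>auto intro!: SUP_least simp: le_fun_def\<close>)
  then show ?thesis
    unfolding nn_integral_def[of M "\<lambda>z. e2ennreal (ereal a - F z)"]
    by (subst ennreal_SUP_add_right)
      (use zero in \<open>auto intro!: SUP_least simp: le_fun_def\<close>)
qed

lemma ereal_expectation_mono:
  assumes "\<And>z. f z \<le> h z"
  shows "ereal_expectation P f \<le> ereal_expectation P h"
  unfolding ereal_expectation_def
  by (intro ereal_minus_mono)
    (auto simp flip: less_eq_ennreal.rep_eq intro!: nn_integral_mono e2ennreal_mono assms)

text \<open>The integrable minorant \<open>G\<close> makes both negative parts have finite integral,
  so these can be subtracted again from the inequality between nonnegative integrals.\<close>

lemma ereal_expectation_shift_le:
  fixes G :: "'a \<Rightarrow> real"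
  assumes P: "prob_space P" and a: "0 \<le> a" and G: "integrable P G"
    and GF: "\<And>z. ereal (G z) \<le> F z"
  shows "ereal_expectation P F \<le> ereal a + ereal_expectation P (\<lambda>z. F z - ereal a)"
proof -
  define A where "A = (\<integral>\<^sup>+ z. e2ennreal (F z) \<partial>completion P)"
  define B where "B = (\<integral>\<^sup>+ z. e2ennreal (- F z) \<partial>completion P)"
  define A' where "A' = (\<integral>\<^sup>+ z. e2ennreal (F z - ereal a) \<partial>completion P)"
  define B' where "B' = (\<integral>\<^sup>+ z. e2ennreal (ereal a - F z) \<partial>completion P)"
  have one: "emeasure (completion P) (space (completion P)) = 1"
    using P by (simp add: prob_space.emeasure_space_1)
  have le: "A + B' \<le> ennreal a + A' + B"
    unfolding A_def B_def A'_def B'_def by (rule nn_integral_shift_le[OF a one])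
  have fin: "B' < \<infinity>"
  proof -
    have [measurable]: "G \<in> borel_measurable P"
      using G by simp
    interpret prob_space P by fact
    have "integrable P (\<lambda>z. a - G z)"
      using G by simp
    then have "(\<integral>\<^sup>+ z. ennreal (norm (a - G z)) \<partial>P) < \<infinity>"
      by (simp add: integrable_iff_bounded)
    moreover have "B' \<le> (\<integral>\<^sup>+ z. ennreal (norm (a - G z)) \<partial>completion P)"
      unfolding B'_def
    \<comment> \<open>The negative part of \<open>F - a\<close> lies below the absolute value of
      \<open>a - G\<close>, because \<open>F\<close> lies above \<open>G\<close>.\<close>
    proof (rule nn_integral_mono)
      fix z
      have "e2ennreal (ereal a - F z) \<le> e2ennreal (ereal a - ereal (G z))"
        by (intro e2ennreal_mono ereal_minus_mono GF order_refl)
      also have "\<dots> \<le> ennreal (norm (a - G z))"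
        by (simp add: ennreal_leI)
      finally show "e2ennreal (ereal a - F z) \<le> ennreal (norm (a - G z))" .
    qed
    ultimately show ?thesis
      by (simp add: nn_integral_completion)
  qed
  have "B \<le> B'"
    unfolding B_def B'_def
  proof (intro nn_integral_mono e2ennreal_mono)
    show "- F z \<le> ereal a - F z" for z
      using a by (cases "F z") auto
  qed
  then have "B < \<infinity>"
    using fin by (rule le_less_trans)
  obtain b b' where b: "B = ennreal b" "0 \<le> b" and b': "B' = ennreal b'" "0 \<le> b'"
    using \<open>B < \<infinity>\<close> fin by (cases B; cases B') auto
  have "ereal a - F z = - (F z - ereal a)" for z
    by (cases "F z") auto
  then have "ereal_expectation P (\<lambda>z. F z - ereal a) = enn2ereal A' - enn2ereal B'"
    unfolding ereal_expectation_def A'_def B'_def by simp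
  moreover have "enn2ereal A - enn2ereal B \<le> ereal a + (enn2ereal A' - enn2ereal B')"
  proof (cases A')
    \<comment> \<open>Here the right side is \<infinity>, because \<open>B'\<close> is
      finite.\<close>
    case top
    then show ?thesis
      using b' by simp
  next
    case (real r)
    then have A: "A + ennreal b' \<le> ennreal (a + r + b)"
      using le a b b' by simp
    then obtain s where s: "A = ennreal s" "0 \<le> s"
      by (cases A) (auto simp: top_unique)
    then have "s + b' \<le> a + r + b"
      using A a real b b' by (simp flip: ennreal_plus)
    then show ?thesis
      using real s b b' by simp
  qed
  ultimately show ?thesis
    unfolding ereal_expectation_def[of P F] A_def B_def by simp
qed

lemma penalized_sup_le:
  assumes c: "cost_function c" and "0 < lam"
  shows "(SUP x'. ereal (g x' x y) - ereal lam * truncated_cost \<epsilon> c x' x)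
    \<le> (SUP x'\<in>cost_ball \<epsilon> c x. ereal (g x' x y))"
proof (rule SUP_least)
  fix x'
  show "ereal (g x' x y) - ereal lam * truncated_cost \<epsilon> c x' x
    \<le> (SUP x'\<in>cost_ball \<epsilon> c x. ereal (g x' x y))"
  proof (cases "c x x' \<le> \<epsilon>")
    case True
    have "c x' x = c x x'" "0 \<le> c x x'"
      using c by (auto simp: cost_function_def)
    then have "ereal (g x' x y) - ereal lam * truncated_cost \<epsilon> c x' x \<le> ereal (g x' x y)"
      using True \<open>0 < lam\<close> by (simp add: truncated_cost_def)
    then show ?thesis
      using True by (intro SUP_upper2[of x']) (auto simp: cost_ball_def)
  next
    \<comment> \<open>Strict positivity of \<open>lam\<close> matters: the penalty is then
      \<infinity> and the term is -\<infinity>, whereas \<open>lam = 0\<close> would leave the point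
      unpenalised.\<close>
    case False
    then have "\<not> c x' x \<le> \<epsilon>"
      using c by (simp add: cost_function_def)
    then show ?thesis
      using \<open>0 < lam\<close> by (simp add: truncated_cost_def)
  qed
qed

text \<open>A point of the ball is penalised by at most \<open>lam * \<epsilon>\<close>. The case
  \<open>lam = 0\<close> is included, since points outside the ball can only raise the right
  side.\<close>

lemma ball_sup_shift_le_penalized_sup:
  assumes c: "cost_function c" and "0 \<le> lam"
  shows "(SUP x'\<in>cost_ball \<epsilon> c x. ereal (g x' x y)) - ereal (lam * \<epsilon>)
    \<le> (SUP x'. ereal (g x' x y) - ereal lam * truncated_cost \<epsilon> c x' x)" (is "_ \<le> ?J")
proof -
  have "ereal (g x' x y) \<le> ?J + ereal (lam * \<epsilon>)" if "x' \<in> cost_ball \<epsilon> c x" for x'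
  proof -
    have *: "c x' x \<le> \<epsilon>"
      using c that by (simp add: cost_function_def cost_ball_def)
    have "ereal (g x' x y) - ereal (lam * \<epsilon>)
        \<le> ereal (g x' x y) - ereal lam * truncated_cost \<epsilon> c x' x"
      using * \<open>0 \<le> lam\<close> by (simp add: truncated_cost_def mult_left_mono)
    also have "\<dots> \<le> ?J"
      by (rule SUP_upper) simp
    finally show ?thesis
      by (subst (asm) ereal_minus_le) simp_all
  qed
  then show ?thesis
    by (simp add: ereal_minus_le SUP_least)
qed

lemma robust_objective_le_penalized_objective:
  fixes g :: "'x::topological_space \<Rightarrow> 'x \<Rightarrow> 'y \<Rightarrow> real"
  assumes "0 < \<epsilon>" and c: "cost_function c" and P: "prob_space P"
    and g: "integrable P (\<lambda>(x, y). g x x y)" and lam: "0 \<le> lam"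
  shows "robust_objective \<epsilon> c P g \<le> penalized_objective \<epsilon> c P g lam"
proof -
  let ?F = "\<lambda>(x, y). SUP x'\<in>cost_ball \<epsilon> c x. ereal (g x' x y)"
  \<comment> \<open>The centre lies in its own ball, so \<open>g x x y\<close> is the integrable
    minorant of the ball supremum.\<close>
  have "x \<in> cost_ball \<epsilon> c x" for x
    using c \<open>0 < \<epsilon>\<close> unfolding cost_function_def cost_ball_def
    by (metis less_imp_le mem_Collect_eq)
  then have "ereal (case z of (x, y) \<Rightarrow> g x x y) \<le> ?F z" for z
    by (auto intro: SUP_upper2 split: prod.split)
  then have "ereal_expectation P ?F
      \<le> ereal (lam * \<epsilon>) + ereal_expectation P (\<lambda>z. ?F z - ereal (lam * \<epsilon>))"
    using \<open>0 < \<epsilon>\<close> lam by (intro ereal_expectation_shift_le[OF P _ g]) auto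
  also have "\<dots> \<le> penalized_objective \<epsilon> c P g lam"
    unfolding penalized_objective_def
    by (intro add_left_mono ereal_expectation_mono)
      (auto intro: ball_sup_shift_le_penalized_sup[OF c lam])
  finally show ?thesis
    unfolding robust_objective_def .
qed

lemma INF_penalized_objective:
  fixes g :: "'x::topological_space \<Rightarrow> 'x \<Rightarrow> 'y \<Rightarrow> real"
  assumes "0 < \<epsilon>" and c: "cost_function c" and P: "prob_space P"
    and g: "integrable P (\<lambda>(x, y). g x x y)"
  shows "(INF lam\<in>{0..}. penalized_objective \<epsilon> c P g lam) = robust_objective \<epsilon> c P g"
proof (rule antisym)
  show "(INF lam\<in>{0..}. penalized_objective \<epsilon> c P g lam) \<le> robust_objective \<epsilon> c P g"
  proof (rule ereal_le_epsilon2)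
    fix e :: real
    assume "0 < e"
    \<comment> \<open>The multiplier \<open>e / \<epsilon>\<close> makes the additive term of the
      penalised objective exactly \<open>e\<close>.\<close>
    then have "0 < e / \<epsilon>"
      using \<open>0 < \<epsilon>\<close> by simp
    have "(INF lam\<in>{0..}. penalized_objective \<epsilon> c P g lam) \<le> penalized_objective \<epsilon> c P g (e / \<epsilon>)"
      using \<open>0 < e / \<epsilon>\<close> by (intro INF_lower) simp
    also have "\<dots> \<le> ereal e + robust_objective \<epsilon> c P g"
      unfolding penalized_objective_def robust_objective_def
      using \<open>0 < \<epsilon>\<close> penalized_sup_le[OF c \<open>0 < e / \<epsilon>\<close>]
      by (intro add_mono ereal_expectation_mono) auto
    finally show "(INF lam\<in>{0..}. penalized_objective \<epsilon> c P g lam)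
        \<le> robust_objective \<epsilon> c P g + ereal e"
      by (simp add: add.commute)
  qed
  show "robust_objective \<epsilon> c P g \<le> (INF lam\<in>{0..}. penalized_objective \<epsilon> c P g lam)"
    by (intro INF_greatest robust_objective_le_penalized_objective assms) simp
qed

theorem theorem1:
  fixes \<epsilon> :: real
    and c :: "'x::polish_space \<Rightarrow> 'x \<Rightarrow> real"
    and P :: "('x \<times> 'y::polish_space) measure"
    and \<Theta> :: "'t set"
    and g :: "'t \<Rightarrow> 'x \<Rightarrow> 'x \<Rightarrow> 'y \<Rightarrow> real"
  assumes "\<epsilon> > 0"
    and "cost_function c"
    and "prob_space P"
    and "sets P = sets borel"
    and "\<Theta> \<noteq> {}"
    and "\<And>\<theta>. \<theta> \<in> \<Theta> \<Longrightarrow> upper_semicont (\<lambda>(x', x, y). g \<theta> x' x y)"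
    and "\<And>\<theta>. \<theta> \<in> \<Theta> \<Longrightarrow> integrable P (\<lambda>(x, y). g \<theta> x x y)"
  shows "(\<forall>\<theta>\<in>\<Theta>. (INF lam\<in>{0..}. penalized_objective \<epsilon> c P (g \<theta>) lam)
                  = robust_objective \<epsilon> c P (g \<theta>))
    \<and> (INF (\<theta>, lam)\<in>\<Theta> \<times> {0..}. penalized_objective \<epsilon> c P (g \<theta>) lam)
        = (INF \<theta>\<in>\<Theta>. robust_objective \<epsilon> c P (g \<theta>))"
proof
  show each: "\<forall>\<theta>\<in>\<Theta>. (INF lam\<in>{0..}. penalized_objective \<epsilon> c P (g \<theta>) lam)
      = robust_objective \<epsilon> c P (g \<theta>)"
    using assms by (blast intro: INF_penalized_objective)
  have "(INF (\<theta>, lam)\<in>\<Theta> \<times> {0..}. penalized_objective \<epsilon> c P (g \<theta>) lam)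
      = (INF \<theta>\<in>\<Theta>. INF lam\<in>{0..}. penalized_objective \<epsilon> c P (g \<theta>) lam)"
    by (rule antisym; intro INF_greatest; force intro!: INF_greatest intro: INF_lower2)
  then show "(INF (\<theta>, lam)\<in>\<Theta> \<times> {0..}. penalized_objective \<epsilon> c P (g \<theta>) lam)
      = (INF \<theta>\<in>\<Theta>. robust_objective \<epsilon> c P (g \<theta>))"
    using each by simp
qed

end
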